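(* Let $E\subset\mathbb{R}^d$ be an open and bounded set (so $\mathrm{meas}(E)<\infty$), and let $1<p<\infty$. Let $(g_n)_{n\ge1}$ be a sequence of functions on $E$ such that $g_n\rightharpoonup\widehat{g}$ weakly in $L^p(E)$ and $g_n\to g$ almost everywhere on $E$. Then $g\in L^p(E)$ and $g=\widehat{g}$ almost everywhere on $E$.
   Context: Functions are real-valued and measurable; $\mathrm{meas}$ denotes Lebesgue measure, and "almost everywhere" is with respect to it. *)

theory Defs
  imports "HOL-Analysis.Analysis"
begin

text \<open>
  Elements of \<open>L\<^sup>p(M)\<close> are represented by functions rather than by classes modulo equality
  almost everywhere. Hence \<open>Lp_norm M p\<close> is only a seminorm. The definitions are meant for
  finite exponents \<open>p \<ge> 1\<close>.
\<close>

definition Lp :: "'a measure \<Rightarrow> real \<Rightarrow> ('a \<Rightarrow> real) set" where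
  "Lp M p = {f \<in> borel_measurable M. integrable M (\<lambda>x. \<bar>f x\<bar> powr p)}"

definition Lp_norm :: "'a measure \<Rightarrow> real \<Rightarrow> ('a \<Rightarrow> real) \<Rightarrow> real" where
  "Lp_norm M p f = (\<integral>x. \<bar>f x\<bar> powr p \<partial>M) powr (1 / p)"

text \<open>
  The continuous linear functionals on \<open>L\<^sup>p(M)\<close>. Linearity and the norm bound force equal
  values on functions that agree almost everywhere, so such a functional is well defined on
  classes. Its values outside \<open>Lp M p\<close> are arbitrary.
\<close>

definition Lp_dual :: "'a measure \<Rightarrow> real \<Rightarrow> (('a \<Rightarrow> real) \<Rightarrow> real) set" where
  "Lp_dual M p = {\<Phi>.
     (\<forall>u\<in>Lp M p. \<forall>v\<in>Lp M p. \<Phi> (\<lambda>x. u x + v x) = \<Phi> u + \<Phi> v) \<and>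
     (\<forall>c. \<forall>u\<in>Lp M p. \<Phi> (\<lambda>x. c * u x) = c * \<Phi> u) \<and>
     (\<exists>C. \<forall>u\<in>Lp M p. \<bar>\<Phi> u\<bar> \<le> C * Lp_norm M p u)}"

definition weakly_converges_Lp ::
    "'a measure \<Rightarrow> real \<Rightarrow> (nat \<Rightarrow> 'a \<Rightarrow> real) \<Rightarrow> ('a \<Rightarrow> real) \<Rightarrow> bool" where
  "weakly_converges_Lp M p f h \<longleftrightarrow>
     (\<forall>n. f n \<in> Lp M p) \<and> h \<in> Lp M p \<and>
     (\<forall>\<Phi>\<in>Lp_dual M p. (\<lambda>n. \<Phi> (f n)) \<longlonglongrightarrow> \<Phi> h)"

end

theory Submission
  imports Defs
begin

text \<open>
  A weak limit and a pointwise limit agree because the space is exhausted, up to a null set, by the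
  increasing sets \<open>A\<^sub>N\<close> on which \<open>\<bar>f\<^sub>k\<bar> \<le> N\<close> for every \<open>k \<ge> N\<close>: a convergent sequence of reals is
  bounded, so almost every point lies in some \<open>A\<^sub>N\<close>. Fix \<open>N\<close> and let \<open>w\<close> be the sign of \<open>g - h\<close> on
  \<open>A\<^sub>N\<close> and zero elsewhere, where \<open>g\<close> is the pointwise and \<open>h\<close> the weak limit. On a finite measure
  space \<open>u \<mapsto> \<integral> w u\<close> is a continuous functional on \<open>L\<^sup>p\<close> (\<open>bounded_multiplier_in_Lp_dual\<close>), so
  \<open>\<integral> w f\<^sub>k\<close> tends to \<open>\<integral> w h\<close>. Since \<open>\<bar>w f\<^sub>k\<bar> \<le> N\<close> for \<open>k \<ge> N\<close>, dominated convergence shows that it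
  also tends to \<open>\<integral> w g\<close>. The difference of the two limits is the integral of \<open>\<bar>g - h\<bar>\<close> over \<open>A\<^sub>N\<close>;
  it vanishes, so \<open>g = h\<close> almost everywhere on \<open>A\<^sub>N\<close>.

  Membership of \<open>g\<close> in \<open>L\<^sup>p\<close> is inherited from \<open>h\<close>.
\<close>

text \<open>
  If \<open>y\<close> exceeds \<open>t\<close>, then \<open>y = y\<^sup>p y\<^bsup>1-p\<^esup>\<close>, and the last factor does not increase with \<open>y\<close>.
  Integrating this bound with \<open>y = \<bar>u x\<bar>\<close> controls the \<open>L\<^sup>1\<close> norm of \<open>u\<close> by its \<open>L\<^sup>p\<close> norm.
\<close>

lemma le_add_powr_mult_powr:
  fixes y t p :: real
  assumes "0 \<le> y" "0 < t" "1 \<le> p"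
  shows "y \<le> t + y powr p * t powr (1 - p)"
proof (cases "y \<le> t")
  case True
  then show ?thesis
    by (simp add: add_increasing2)
next
  case False
  then have "y = y powr p * y powr (1 - p)"
    using assms by (simp flip: powr_add)
  also have "\<dots> \<le> y powr p * t powr (1 - p)"
    using False assms by (intro mult_left_mono powr_mono2') auto
  finally show ?thesis
    using assms by linarith
qed

lemma (in finite_measure) Lp_imp_integrable:
  assumes "u \<in> Lp M p" "1 \<le> p"
  shows "integrable M u"
proof (rule Bochner_Integration.integrable_bound)
  show "integrable M (\<lambda>x. 1 + \<bar>u x\<bar> powr p)"
    using assms by (auto simp: Lp_def)
  show "u \<in> borel_measurable M"
    using assms by (auto simp: Lp_def)
  show "AE x in M. norm (u x) \<le> norm (1 + \<bar>u x\<bar> powr p)"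
    using le_add_powr_mult_powr[of "\<bar>u _\<bar>" 1 p] assms by (intro AE_I2) simp
qed

text \<open>
  Taking \<open>t\<close> in the pointwise bound to be the norm makes both terms multiples of it, because then
  \<open>t\<^sup>p t\<^bsup>1-p\<^esup> = t\<close>. A vanishing norm is treated apart, since the pointwise bound needs \<open>t > 0\<close>.
\<close>

lemma (in finite_measure) integral_abs_le_Lp_norm:
  assumes u: "u \<in> Lp M p" and p: "1 \<le> p"
  shows "(\<integral>x. \<bar>u x\<bar> \<partial>M) \<le> (measure M (space M) + 1) * Lp_norm M p u"
proof -
  have meas: "u \<in> borel_measurable M" and int: "integrable M (\<lambda>x. \<bar>u x\<bar> powr p)"
    using u by (auto simp: Lp_def)
  define I where "I = (\<integral>x. \<bar>u x\<bar> powr p \<partial>M)"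
  define t where "t = I powr (1 / p)"
  have "0 \<le> I"
    unfolding I_def by simp
  show ?thesis
  proof (cases "I = 0")
    case True
    then have "AE x in M. \<bar>u x\<bar> powr p = 0"
      using integral_nonneg_eq_0_iff_AE[OF int] by (simp add: I_def)
    then have "AE x in M. \<bar>u x\<bar> = 0"
      by eventually_elim simp
    then have "(\<integral>x. \<bar>u x\<bar> \<partial>M) = 0"
      by (rule integral_eq_zero_AE)
    then show ?thesis
      by (simp add: Lp_norm_def)
  next
    case False
    with \<open>0 \<le> I\<close> have "0 < I" by simp
    then have "0 < t" by (simp add: t_def)
    have t_powr: "t powr p = I"
      using p \<open>0 < I\<close> by (simp add: t_def powr_powr)
    have "(\<integral>x. \<bar>u x\<bar> \<partial>M) \<le> (\<integral>x. t + \<bar>u x\<bar> powr p * t powr (1 - p) \<partial>M)"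
      using int Lp_imp_integrable[OF u p] le_add_powr_mult_powr \<open>0 < t\<close> p
      by (intro integral_mono) auto
    also have "\<dots> = measure M (space M) * t + t powr p * t powr (1 - p)"
      using int by (simp add: t_powr I_def)
    also have "\<dots> = (measure M (space M) + 1) * t"
      using \<open>0 < t\<close> by (simp add: algebra_simps flip: powr_add)
    finally show ?thesis
      by (simp add: Lp_norm_def t_def I_def)
  qed
qed

lemma (in finite_measure) bounded_multiplier_in_Lp_dual:
  fixes w :: "'a \<Rightarrow> real"
  assumes w: "w \<in> borel_measurable M" and bound: "\<And>x. \<bar>w x\<bar> \<le> 1" and p: "1 \<le> p"
  shows "(\<lambda>u. \<integral>x. w x * u x \<partial>M) \<in> Lp_dual M p"
proof -
  have le: "\<bar>w x * u x\<bar> \<le> \<bar>u x\<bar>" for u :: "'a \<Rightarrow> real" and x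
    using mult_right_mono[OF bound[of x], of "\<bar>u x\<bar>"] by (simp add: abs_mult)
  have int: "integrable M (\<lambda>x. w x * u x)" if "u \<in> Lp M p" for u
    using Lp_imp_integrable[OF that p]
    by (rule Bochner_Integration.integrable_bound) (use that w le in \<open>auto simp: Lp_def\<close>)
  have "\<bar>\<integral>x. w x * u x \<partial>M\<bar> \<le> (measure M (space M) + 1) * Lp_norm M p u"
    if u: "u \<in> Lp M p" for u
  proof -
    have "\<bar>\<integral>x. w x * u x \<partial>M\<bar> \<le> (\<integral>x. \<bar>w x * u x\<bar> \<partial>M)"
      by (rule integral_abs_bound)
    also have "\<dots> \<le> (\<integral>x. \<bar>u x\<bar> \<partial>M)"
      using int[OF u] Lp_imp_integrable[OF u p] le by (intro integral_mono) auto
    also have "\<dots> \<le> (measure M (space M) + 1) * Lp_norm M p u"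
      using u p by (rule integral_abs_le_Lp_norm)
    finally show ?thesis .
  qed
  then show ?thesis
    using int by (auto simp: Lp_dual_def distrib_left mult.left_commute)
qed

lemma Lp_cong_AE:
  assumes "f \<in> Lp M p" "g \<in> borel_measurable M" "AE x in M. g x = f x"
  shows "g \<in> Lp M p"
proof -
  have "integrable M (\<lambda>x. \<bar>g x\<bar> powr p) \<longleftrightarrow> integrable M (\<lambda>x. \<bar>f x\<bar> powr p)"
    using assms by (intro integrable_cong_AE) (auto simp: Lp_def)
  then show ?thesis
    using assms by (auto simp: Lp_def)
qed

theorem (in finite_measure) weak_Lp_limit_eq_pointwise_limit:
  assumes p: "1 \<le> p"
    and g: "g \<in> borel_measurable M"
    and weak: "weakly_converges_Lp M p f h"
    and lim: "AE x in M. (\<lambda>n. f n x) \<longlonglongrightarrow> g x"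
  shows "AE x in M. g x = h x"
proof -
  have f [measurable]: "f n \<in> borel_measurable M" and h: "h \<in> Lp M p" for n
    using weak by (auto simp: weakly_converges_Lp_def Lp_def)
  have [measurable]: "h \<in> borel_measurable M"
    using h by (auto simp: Lp_def)
  note [measurable] = g
  define A where "A N = {x \<in> space M. \<forall>k\<ge>N. \<bar>f k x\<bar> \<le> real N}" for N
  have A [measurable]: "A N \<in> sets M" for N
    unfolding A_def by measurable
  have eq_on_A: "AE x in M. x \<in> A N \<longrightarrow> g x = h x" for N
  proof -
    \<comment> \<open>Multiplying by \<open>sgn (g - h)\<close> turns \<open>g - h\<close> into its absolute value, so that one test function
      controls both signs of the difference.\<close>
    define w where "w x = indicator (A N) x * sgn (g x - h x)" for x
    have w [measurable]: "w \<in> borel_measurable M"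
      unfolding w_def by measurable
    have w_le: "\<bar>w x\<bar> \<le> 1" for x
      by (simp add: w_def indicator_def sgn_if)
    have w_zero: "w x = 0" if "x \<notin> A N" for x
      using that by (simp add: w_def)
    \<comment> \<open>The shift by \<open>N\<close> discards the terms that are not controlled on \<open>A N\<close>, so the constant \<open>N\<close>
      dominates the whole sequence.\<close>
    have bound: "norm (w x * f (k + N) x) \<le> real N" for x k
    proof (cases "x \<in> A N")
      case True
      then have "\<bar>w x\<bar> * \<bar>f (k + N) x\<bar> \<le> 1 * real N"
        using w_le by (intro mult_mono) (auto simp: A_def)
      then show ?thesis by (simp add: abs_mult)
    qed (simp add: w_zero)
    have lim_w: "AE x in M. (\<lambda>k. w x * f (k + N) x) \<longlonglongrightarrow> w x * g x"
      using lim by eventually_elim (intro tendsto_intros LIMSEQ_ignore_initial_segment)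
    have int_g: "integrable M (\<lambda>x. w x * g x)"
      by (rule integrable_dominated_convergence[where w = "\<lambda>_. real N"])
        (use lim_w bound in auto)
    have to_g: "(\<lambda>k. \<integral>x. w x * f (k + N) x \<partial>M) \<longlonglongrightarrow> (\<integral>x. w x * g x \<partial>M)"
      by (rule integral_dominated_convergence[where w = "\<lambda>_. real N"])
        (use lim_w bound in auto)
    have "(\<lambda>k. \<integral>x. w x * f k x \<partial>M) \<longlonglongrightarrow> (\<integral>x. w x * h x \<partial>M)"
      using weak[unfolded weakly_converges_Lp_def]
      by (auto dest!: bspec[OF _ bounded_multiplier_in_Lp_dual[OF w w_le p]])
    then have to_h: "(\<lambda>k. \<integral>x. w x * f (k + N) x \<partial>M) \<longlonglongrightarrow> (\<integral>x. w x * h x \<partial>M)"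
      by (rule LIMSEQ_ignore_initial_segment)
    have int_h: "integrable M (\<lambda>x. w x * h x)"
      using Lp_imp_integrable[OF h p]
    proof (rule Bochner_Integration.integrable_bound)
      show "AE x in M. norm (w x * h x) \<le> norm (h x)"
        using mult_right_mono[OF w_le, of "\<bar>h _\<bar>"] by (simp add: abs_mult)
    qed measurable
    have abs_eq: "w x * g x - w x * h x = indicator (A N) x * \<bar>g x - h x\<bar>" for x
      by (simp add: w_def abs_sgn algebra_simps)
    have "(\<integral>x. indicator (A N) x * \<bar>g x - h x\<bar> \<partial>M) = 0"
      using LIMSEQ_unique[OF to_g to_h] Bochner_Integration.integral_diff[OF int_g int_h]
      by (simp add: abs_eq)
    moreover have "integrable M (\<lambda>x. indicator (A N) x * \<bar>g x - h x\<bar>)"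
      using Bochner_Integration.integrable_diff[OF int_g int_h] by (simp add: abs_eq)
    ultimately have "AE x in M. indicator (A N) x * \<bar>g x - h x\<bar> = 0"
      by (subst (asm) integral_nonneg_eq_0_iff_AE) auto
    then show ?thesis
      by eventually_elim (auto simp: indicator_def)
  qed
  have "AE x in M. \<forall>N. x \<in> A N \<longrightarrow> g x = h x"
    unfolding AE_all_countable using eq_on_A by (rule allI)
  then show ?thesis
    using lim AE_space
  proof eventually_elim
    case (elim x)
    then obtain K where K: "\<And>n. \<bar>f n x\<bar> \<le> K"
      using convergent_imp_Bseq[of "\<lambda>n. f n x"] by (auto simp: convergent_def Bseq_def)
    obtain N where "K \<le> real N"
      using real_arch_simple by blast
    then have "x \<in> A N"
      using elim K by (auto simp: A_def intro: order_trans)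
    then show ?case
      using elim by blast
  qed
qed

theorem lemma3p1:
  fixes E :: "(real ^ 'd) set" and p :: real
    and g_seq :: "nat \<Rightarrow> real ^ 'd \<Rightarrow> real" and g g_hat :: "real ^ 'd \<Rightarrow> real"
  assumes "open E" and "bounded E" and "1 < p"
    and "g \<in> borel_measurable (lebesgue_on E)"
    and "weakly_converges_Lp (lebesgue_on E) p g_seq g_hat"
    and "AE x in lebesgue_on E. (\<lambda>n. g_seq n x) \<longlonglongrightarrow> g x"
  shows "g \<in> Lp (lebesgue_on E) p \<and> (AE x in lebesgue_on E. g x = g_hat x)"
proof -
  have "E \<in> lmeasurable"
    using assms by (simp add: bounded_set_imp_lmeasurable)
  then interpret finite_measure "lebesgue_on E"
    by (rule finite_measure_lebesgue_on)
  have eq: "AE x in lebesgue_on E. g x = g_hat x"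
    using assms by (intro weak_Lp_limit_eq_pointwise_limit[where p = p and f = g_seq]) simp_all
  have "g_hat \<in> Lp (lebesgue_on E) p"
    using assms(5) by (simp add: weakly_converges_Lp_def)
  then have "g \<in> Lp (lebesgue_on E) p"
    using assms(4) eq by (rule Lp_cong_AE)
  with eq show ?thesis
    by blast
qed

end
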